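(* Let $G$ be a finite abelian group, $S\subseteq G$ a symmetric subset with $k=|S|$, and $\alpha_0>0$. The Green's function of the uniform diffusion equation on the Cayley graph $X(G,S)$, that is, the inverse $\mathcal{G}=H_0^{-1}$ of the operator $H_0=L+\alpha_0I$, is $$\mathcal{G}(f)(x)=\sum_{\chi\in\hat G}\ \sum_{y\in G}\frac{1}{\lambda_\chi+\alpha_0}\,f(y)\,\overline{\chi(y)}\,\chi(x),\qquad \lambda_\chi=k-\sum_{s\in S}\overline{\chi(s)}.$$
   Context: A subset $S$ of a group $G$ is symmetric if $g\in S$ implies $g^{-1}\in S$. The Cayley graph $X(G,S)$ has vertex set $G$ and edge set $\{(g,h)\in G\times G: gh^{-1}\in S\}$. For functions on $G$, $(f\ast g)(x)=\sum_{y\in G}f(y)g(y^{-1}x)$. The Laplacian is $L(f)(x)=k f(x)-(\delta_S\ast f)(x)$, where $k=|S|$ and $\delta_S$ is the characteristic function of $S$. The operators act on $\ell^2(G)$, the space of complex-valued functions on $G$; here $f\in\ell^2(G)$ and $x\in G$. The dual group $\hat G=\mathrm{Hom}(G,\mathbb{T})$ is the group of characters of $G$, where $\mathbb{T}$ is the multiplicative group of complex numbers of modulus one. The graph has no boundary here, and $\alpha_0$ is the constant absorption.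
   Formalization: The displayed formula for G(f)(x) needs a factor 1/|G| in front of the double sum, since the characters are not normalized; as printed it fails for |G|>1 (for f=1 it gives |G|/α_0 instead of 1/α_0). *)

theory Defs
  imports "HOL-Algebra.Algebra" Complex_Main
begin

definition symmetric_subset :: "('a, 'b) monoid_scheme \<Rightarrow> 'a set \<Rightarrow> bool" where
  "symmetric_subset G S \<longleftrightarrow> S \<subseteq> carrier G \<and> (\<forall>g\<in>S. inv\<^bsub>G\<^esub> g \<in> S)"

definition cayley_edges :: "('a, 'b) monoid_scheme \<Rightarrow> 'a set \<Rightarrow> ('a \<times> 'a) set" where
  "cayley_edges G S = {(g, h) \<in> carrier G \<times> carrier G. g \<otimes>\<^bsub>G\<^esub> inv\<^bsub>G\<^esub> h \<in> S}"

(* Functions on G are represented by HOL functions that are undefined outside the carrier, so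
   that they are determined by their values on G. Only finite G is considered, hence
   square-summability is automatic. *)
definition ell2 :: "('a, 'b) monoid_scheme \<Rightarrow> ('a \<Rightarrow> complex) set" where
  "ell2 G = carrier G \<rightarrow>\<^sub>E UNIV"

definition convolution ::
    "('a, 'b) monoid_scheme \<Rightarrow> ('a \<Rightarrow> complex) \<Rightarrow> ('a \<Rightarrow> complex) \<Rightarrow> 'a \<Rightarrow> complex" where
  "convolution G f g =
     (\<lambda>x\<in>carrier G. \<Sum>y\<in>carrier G. f y * g (inv\<^bsub>G\<^esub> y \<otimes>\<^bsub>G\<^esub> x))"

definition char_fun :: "('a, 'b) monoid_scheme \<Rightarrow> 'a set \<Rightarrow> 'a \<Rightarrow> complex" where
  "char_fun G S = (\<lambda>x\<in>carrier G. if x \<in> S then 1 else 0)"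

definition laplacian ::
    "('a, 'b) monoid_scheme \<Rightarrow> 'a set \<Rightarrow> ('a \<Rightarrow> complex) \<Rightarrow> 'a \<Rightarrow> complex" where
  "laplacian G S f =
     (\<lambda>x\<in>carrier G. of_nat (card S) * f x - convolution G (char_fun G S) f x)"

definition diffusion_operator ::
    "('a, 'b) monoid_scheme \<Rightarrow> 'a set \<Rightarrow> real \<Rightarrow> ('a \<Rightarrow> complex) \<Rightarrow> 'a \<Rightarrow> complex" where
  "diffusion_operator G S \<alpha>\<^sub>0 f =
     (\<lambda>x\<in>carrier G. laplacian G S f x + of_real \<alpha>\<^sub>0 * f x)"

(* The inverse operator on the space of functions on G; meaningful when
   the diffusion operator is a bijection of that space. *)
definition greens_function ::
    "('a, 'b) monoid_scheme \<Rightarrow> 'a set \<Rightarrow> real \<Rightarrow> ('a \<Rightarrow> complex) \<Rightarrow> 'a \<Rightarrow> complex" where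
  "greens_function G S \<alpha>\<^sub>0 = inv_into (ell2 G) (diffusion_operator G S \<alpha>\<^sub>0)"

definition circle_group :: "complex monoid" where
  "circle_group = \<lparr>carrier = {z. cmod z = 1}, monoid.mult = (*), one = 1\<rparr>"

(* The library's hom does not constrain values outside the carrier; without extensionality
   each character would have many representatives and sums over the dual would be wrong. *)
definition dual_group :: "('a, 'b) monoid_scheme \<Rightarrow> ('a \<Rightarrow> complex) set" where
  "dual_group G = hom G circle_group \<inter> extensional (carrier G)"

definition cayley_eigenvalue :: "'a set \<Rightarrow> ('a \<Rightarrow> complex) \<Rightarrow> complex" where
  "cayley_eigenvalue S \<chi> = of_nat (card S) - (\<Sum>s\<in>S. cnj (\<chi> s))"

(* The operator above is the Laplacian of the graph with edges cayley_edges. *)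
lemma laplacian_cayley_edges:
  fixes G (structure)
  assumes "group G" "finite (carrier G)" "S \<subseteq> carrier G" "x \<in> carrier G"
  shows "laplacian G S f x = (\<Sum>h | (x, h) \<in> cayley_edges G S. f x - f h)"
proof -
  interpret group G by fact
  have fin: "finite S" using assms finite_subset by blast
  have N: "{h. (x, h) \<in> cayley_edges G S} = (\<lambda>s. inv s \<otimes> x) ` S"
  proof (intro equalityI subsetI)
    fix h assume "h \<in> {h. (x, h) \<in> cayley_edges G S}"
    then have h: "h \<in> carrier G" "x \<otimes> inv h \<in> S" by (auto simp: cayley_edges_def)
    have "inv (x \<otimes> inv h) \<otimes> x = h"
      using h assms by (simp add: inv_mult_group m_assoc)
    then show "h \<in> (\<lambda>s. inv s \<otimes> x) ` S" using h by (metis image_eqI)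
  next
    fix h assume "h \<in> (\<lambda>s. inv s \<otimes> x) ` S"
    then obtain s where s: "s \<in> S" "h = inv s \<otimes> x" by auto
    then have sc: "s \<in> carrier G" using assms by auto
    have "x \<otimes> inv h = s"
      using s sc assms by (simp add: inv_mult_group m_assoc[symmetric])
    then show "h \<in> {h. (x, h) \<in> cayley_edges G S}"
      using s sc assms by (simp add: cayley_edges_def)
  qed
  have inj: "inj_on (\<lambda>s. inv s \<otimes> x) S"
  proof (rule inj_onI)
    fix s t assume st: "s \<in> S" "t \<in> S" "inv s \<otimes> x = inv t \<otimes> x"
    then have c: "s \<in> carrier G" "t \<in> carrier G" using assms by auto
    then have "inv s = inv t" using st assms by simp
    then show "s = t" using c by (metis inv_inv)
  qed
  have "(\<Sum>y\<in>carrier G. char_fun G S y * f (inv y \<otimes> x)) = (\<Sum>s\<in>S. f (inv s \<otimes> x))"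
    using assms by (intro sum.mono_neutral_cong_right) (auto simp: char_fun_def)
  then show ?thesis
    using assms by (simp add: laplacian_def convolution_def N sum.reindex[OF inj] sum_subtractf card_image[OF inj])
qed

end

(* The characters diagonalize the diffusion operator: the Fourier coefficients of H_0 f are those
   of f times lambda_chi + alpha_0, which has positive real part, so dividing the coefficients by
   this number inverts H_0. Fourier inversion needs the orthogonality of the columns of the
   character table, and hence that characters separate points. This holds because a homomorphism
   from a subgroup H to the nonzero complex numbers extends to the subgroup generated by H and one
   further element a, its value at a being any m-th root of its value at a^m, where m > 0 is the
   least exponent with a^m in H. *)
theory Submission imports Defs begin

context comm_group begin

definition partial_character :: "'a set \<Rightarrow> ('a \<Rightarrow> complex) \<Rightarrow> bool" where
  "partial_character H \<chi> \<longleftrightarrow> subgroup H G \<and> \<chi> \<one> = 1 \<and>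
     (\<forall>x\<in>H. \<forall>y\<in>H. \<chi> (x \<otimes> y) = \<chi> x * \<chi> y)"

lemma partial_character_pow:
  assumes "partial_character H \<chi>" "x \<in> H"
  shows "x [^] (i::nat) \<in> H" "\<chi> (x [^] i) = \<chi> x ^ i"
proof -
  interpret H: subgroup H G using assms by (simp add: partial_character_def)
  have *: "x [^] (i::nat) \<in> H" for i
    using assms(2) by (induction i) auto
  then show "x [^] i \<in> H" .
  show "\<chi> (x [^] i) = \<chi> x ^ i"
    using assms * by (induction i) (auto simp: partial_character_def mult.commute)
qed

lemma partial_character_nonzero:
  assumes "partial_character H \<chi>" "x \<in> H"
  shows "\<chi> x \<noteq> 0"
proof -
  interpret H: subgroup H G using assms by (simp add: partial_character_def)
  have "inv x \<in> H" using assms(2) by simp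
  then have "\<chi> (x \<otimes> inv x) = \<chi> x * \<chi> (inv x)" "\<chi> \<one> = 1"
    using assms by (auto simp only: partial_character_def)
  then have "\<chi> x * \<chi> (inv x) = 1"
    using assms(2) by (simp add: H.mem_carrier)
  then show ?thesis by auto
qed

lemma least_pow_dvd:
  assumes "subgroup H G" "a \<in> carrier G" "0 < m" "a [^] m \<in> H"
    and least: "\<And>d::nat. 0 < d \<Longrightarrow> d < m \<Longrightarrow> a [^] d \<notin> H"
    and d: "a [^] d \<in> H"
  shows "m dvd d"
proof -
  interpret H: subgroup H G by fact
  have "(a [^] m) [^] i \<in> H" for i :: nat
    using assms(4) by (induction i) auto
  then have *: "a [^] (m * (d div m)) \<in> H"
    using assms(2) by (simp add: nat_pow_pow)
  have "a [^] d = a [^] (m * (d div m)) \<otimes> a [^] (d mod m)"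
    using assms(2) by (simp add: nat_pow_mult)
  then have "a [^] (d mod m) = inv (a [^] (m * (d div m))) \<otimes> a [^] d"
    using assms(2) by (simp add: inv_solve_left)
  also have "\<dots> \<in> H" using * d by simp
  finally have "\<not> 0 < d mod m" using least[of "d mod m"] \<open>0 < m\<close> by auto
  then show ?thesis by (simp add: dvd_eq_mod_eq_0)
qed

lemma extend_partial_character:
  assumes fin: "finite (carrier G)" and \<chi>: "partial_character H \<chi>" and a: "a \<in> carrier G"
    and m: "0 < m" "a [^] m \<in> H"
    and least: "\<And>d::nat. 0 < d \<Longrightarrow> d < m \<Longrightarrow> a [^] d \<notin> H"
    and z: "z ^ m = \<chi> (a [^] m)"
  obtains K \<psi> where "partial_character K \<psi>" "H \<subseteq> K" "a \<in> K" "\<And>h. h \<in> H \<Longrightarrow> \<psi> h = \<chi> h" "\<psi> a = z"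
proof -
  interpret H: subgroup H G using \<chi> by (simp add: partial_character_def)
  have \<chi>1: "\<chi> \<one> = 1" and \<chi>m: "\<And>x y. x \<in> H \<Longrightarrow> y \<in> H \<Longrightarrow> \<chi> (x \<otimes> y) = \<chi> x * \<chi> y"
    using \<chi> by (auto simp: partial_character_def)
  define K where "K = {h \<otimes> a [^] (i::nat) | h i. h \<in> H}"
  define \<psi> where "\<psi> g = (THE w. \<exists>h\<in>H. \<exists>i::nat. g = h \<otimes> a [^] i \<and> w = \<chi> h * z ^ i)" for g
  have pow: "\<chi> (a [^] d) = z ^ d" if d: "a [^] d \<in> H" for d :: nat
  proof -
    obtain q where q: "d = m * q"
      using least_pow_dvd[OF H.subgroup_axioms a m least d] by (auto elim: dvdE)
    show ?thesis
      using partial_character_pow(2)[OF \<chi> m(2), of q] a z by (simp add: q nat_pow_pow power_mult)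
  qed
  have le: "\<chi> h * z ^ i = \<chi> h' * z ^ j"
    if h: "h \<in> H" "h' \<in> H" and eq: "h \<otimes> a [^] i = h' \<otimes> a [^] j" and ij: "i \<le> j" for h h' and i j :: nat
  proof -
    obtain d where j: "j = d + i" using ij by (metis le_add_diff_inverse2)
    have "h \<otimes> a [^] i = (h' \<otimes> a [^] d) \<otimes> a [^] i"
      using eq h a by (simp add: j nat_pow_mult[symmetric] m_assoc)
    then have hh: "h = h' \<otimes> a [^] d"
      using h a by simp
    then have "inv h' \<otimes> h = a [^] d"
      using h a by (simp add: m_assoc[symmetric])
    then have d: "a [^] d \<in> H" using h by (metis H.m_closed H.m_inv_closed)
    have "\<chi> h = \<chi> h' * z ^ d"
      using \<chi>m[OF h(2) d] pow[OF d] hh by simp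
    then show ?thesis by (simp add: j power_add)
  qed
  have \<psi>: "\<psi> (h \<otimes> a [^] i) = \<chi> h * z ^ i" if "h \<in> H" for h and i :: nat
    unfolding \<psi>_def
  proof (rule the_equality)
    show "\<exists>h'\<in>H. \<exists>j. h \<otimes> a [^] i = h' \<otimes> a [^] j \<and> \<chi> h * z ^ i = \<chi> h' * z ^ j"
      using that by blast
  next
    fix w assume "\<exists>h'\<in>H. \<exists>j. h \<otimes> a [^] i = h' \<otimes> a [^] j \<and> w = \<chi> h' * z ^ j"
    then obtain h' j where "h' \<in> H" "h \<otimes> a [^] i = h' \<otimes> a [^] j" "w = \<chi> h' * z ^ j" by blast
    then show "w = \<chi> h * z ^ i"
      using le[of h h' i j] le[of h' h j i] that by (cases "i \<le> j") auto
  qed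
  have mult: "(h \<otimes> a [^] i) \<otimes> (h' \<otimes> a [^] j) = (h \<otimes> h') \<otimes> a [^] (i + j)"
    if "h \<in> H" "h' \<in> H" for h h' and i j :: nat
    using that a by (simp add: nat_pow_mult[symmetric] m_ac)
  have H_K: "H \<subseteq> K"
  proof
    fix h assume "h \<in> H"
    then have "h = h \<otimes> a [^] (0::nat)" by simp
    then show "h \<in> K" unfolding K_def using \<open>h \<in> H\<close> by blast
  qed
  have "subgroup K G"
  proof (rule subgroupI)
    show "K \<subseteq> carrier G" using a by (auto simp: K_def)
    show "K \<noteq> {}" using H_K H.one_closed by blast
  next
    fix g assume "g \<in> K"
    then obtain h and i :: nat where g: "h \<in> H" "g = h \<otimes> a [^] i" by (auto simp: K_def)
    have "0 < order G" using fin order_gt_0_iff_finite by blast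
    then have "i * (order G - 1) + i = order G * i" by (cases "order G") auto
    then have "a [^] (i * (order G - 1)) \<otimes> a [^] i = (a [^] order G) [^] i"
      using a by (simp only: nat_pow_mult nat_pow_pow)
    then have "a [^] (i * (order G - 1)) \<otimes> a [^] i = \<one>"
      using a by (simp only: pow_order_eq_1 nat_pow_one)
    then have "inv (a [^] i) = a [^] (i * (order G - 1))"
      using a by (intro inv_equality) auto
    then have "inv g = inv h \<otimes> a [^] (i * (order G - 1))"
      using g a by (simp add: inv_mult)
    then show "inv g \<in> K" unfolding K_def using g by blast
  next
    fix g g' assume "g \<in> K" "g' \<in> K"
    then obtain h h' and i j :: nat where g: "h \<in> H" "g = h \<otimes> a [^] i" "h' \<in> H" "g' = h' \<otimes> a [^] j"
      by (auto simp: K_def)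
    then show "g \<otimes> g' \<in> K" unfolding K_def using mult[of h h' i j] by blast
  qed
  moreover have "\<psi> h = \<chi> h" if "h \<in> H" for h
    using \<psi>[OF that, of 0] that by simp
  moreover have "\<psi> (g \<otimes> g') = \<psi> g * \<psi> g'" if K: "g \<in> K" "g' \<in> K" for g g'
  proof -
    from K obtain h h' and i j :: nat
      where g: "h \<in> H" "g = h \<otimes> a [^] i" "h' \<in> H" "g' = h' \<otimes> a [^] j"
      by (auto simp: K_def)
    then show ?thesis
      by (simp add: mult \<psi> \<chi>m power_add)
  qed
  moreover have "\<psi> a = z" using \<psi>[of \<one> 1] a \<chi>1 by simp
  moreover have "a \<in> K"
  proof -
    have "a = \<one> \<otimes> a [^] (1::nat)" using a by simp
    then show ?thesis unfolding K_def using H.one_closed by blast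
  qed
  ultimately show thesis
    using that[of K \<psi>] H_K \<chi>1 by (auto simp: partial_character_def)
qed

lemma least_pow_in_subgroup:
  assumes "finite (carrier G)" "subgroup H G" "a \<in> carrier G"
  obtains m :: nat where "0 < m" "a [^] m \<in> H" "\<And>d::nat. 0 < d \<Longrightarrow> d < m \<Longrightarrow> a [^] d \<notin> H"
proof -
  define P where "P m \<longleftrightarrow> 0 < m \<and> a [^] m \<in> H" for m :: nat
  have "P (order G)"
    using assms order_gt_0_iff_finite pow_order_eq_1 by (auto simp: P_def subgroup.one_closed)
  then have "P (LEAST m. P m)" by (rule LeastI)
  moreover have "\<not> P d" if "d < (LEAST m. P m)" for d
    using that by (rule not_less_Least)
  ultimately show thesis using that[of "LEAST m. P m"] by (auto simp: P_def)
qed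

lemma partial_character_extends:
  assumes fin: "finite (carrier G)" and "partial_character H \<chi>"
  obtains \<psi> where "partial_character (carrier G) \<psi>" "\<And>h. h \<in> H \<Longrightarrow> \<psi> h = \<chi> h"
proof -
  have "\<exists>\<psi>. partial_character (carrier G) \<psi> \<and> (\<forall>h\<in>H. \<psi> h = \<chi> h)"
    using assms(2)
  proof (induction "card (carrier G - H)" arbitrary: H \<chi> rule: less_induct)
    case less
    then have H: "subgroup H G" by (simp add: partial_character_def)
    show ?case
    proof (cases "H = carrier G")
      case True
      then show ?thesis using less.prems by blast
    next
      case False
      then obtain a where a: "a \<in> carrier G" "a \<notin> H"
        using subgroup.subset[OF H] by blast
      obtain m :: nat where m: "0 < m" "a [^] m \<in> H" "\<And>d::nat. 0 < d \<Longrightarrow> d < m \<Longrightarrow> a [^] d \<notin> H"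
        using least_pow_in_subgroup[OF fin H a(1)] by blast
      have "card {z. z ^ m = \<chi> (a [^] m)} = m"
        using partial_character_nonzero[OF less.prems m(2)] m(1) by (rule card_nth_roots)
      then obtain z where "z ^ m = \<chi> (a [^] m)"
        using m(1) by (metis (mono_tags, lifting) card.empty empty_Collect_eq less_irrefl)
      then obtain K \<psi> where K: "partial_character K \<psi>" "H \<subseteq> K" "a \<in> K" "\<And>h. h \<in> H \<Longrightarrow> \<psi> h = \<chi> h"
        using extend_partial_character[OF fin less.prems a(1) m] by metis
      have "card (carrier G - K) < card (carrier G - H)"
        using fin a K by (intro psubset_card_mono) auto
      from less.hyps[OF this K(1)] show ?thesis using K(2,4) by (metis subsetD)
    qed
  qed
  then show thesis using that by blast
qed

lemma dual_groupD:
  assumes "\<chi> \<in> dual_group G"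
  shows dual_group_mult: "\<And>x y. x \<in> carrier G \<Longrightarrow> y \<in> carrier G \<Longrightarrow> \<chi> (x \<otimes> y) = \<chi> x * \<chi> y"
    and dual_group_norm: "\<And>x. x \<in> carrier G \<Longrightarrow> cmod (\<chi> x) = 1"
    and dual_group_one: "\<chi> \<one> = 1"
    and dual_group_inv: "\<And>x. x \<in> carrier G \<Longrightarrow> \<chi> (inv x) = cnj (\<chi> x)"
proof -
  show mult: "\<And>x y. x \<in> carrier G \<Longrightarrow> y \<in> carrier G \<Longrightarrow> \<chi> (x \<otimes> y) = \<chi> x * \<chi> y"
    and norm: "\<And>x. x \<in> carrier G \<Longrightarrow> cmod (\<chi> x) = 1"
    using assms by (auto simp: dual_group_def hom_def circle_group_def)
  have "\<chi> \<one> = \<chi> \<one> * \<chi> \<one>" using mult[of \<one> \<one>] by simp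
  then show one: "\<chi> \<one> = 1" using norm[of \<one>] by auto
  fix x assume x: "x \<in> carrier G"
  have "\<chi> x * \<chi> (inv x) = 1"
    using mult[of x "inv x"] one x by simp
  moreover have "\<chi> x * cnj (\<chi> x) = 1"
    using norm[OF x] by (simp add: complex_norm_square[symmetric])
  ultimately show "\<chi> (inv x) = cnj (\<chi> x)"
    by (metis mult_cancel_left mult_zero_left zero_neq_one)
qed

lemma dual_groupI:
  assumes "\<And>x y. x \<in> carrier G \<Longrightarrow> y \<in> carrier G \<Longrightarrow> \<chi> (x \<otimes> y) = \<chi> x * \<chi> y"
    and "\<And>x. x \<in> carrier G \<Longrightarrow> cmod (\<chi> x) = 1"
  shows "restrict \<chi> (carrier G) \<in> dual_group G"
  using assms by (auto simp: dual_group_def hom_def circle_group_def)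

lemma dual_group_eqI:
  assumes "\<chi> \<in> dual_group G" "\<psi> \<in> dual_group G" "\<And>x. x \<in> carrier G \<Longrightarrow> \<chi> x = \<psi> x"
  shows "\<chi> = \<psi>"
  using assms by (auto simp: dual_group_def intro: extensionalityI)

lemma dual_group_separates:
  assumes fin: "finite (carrier G)" and x: "x \<in> carrier G" "x \<noteq> \<one>"
  obtains \<chi> where "\<chi> \<in> dual_group G" "\<chi> x \<noteq> 1"
proof -
  have triv: "partial_character {\<one>} (\<lambda>_. 1)"
    by (simp add: partial_character_def triv_subgroup)
  then have "subgroup {\<one>} G" by (simp add: partial_character_def)
  then obtain m :: nat where m: "0 < m" "x [^] m \<in> {\<one>}" "\<And>d::nat. 0 < d \<Longrightarrow> d < m \<Longrightarrow> x [^] d \<notin> {\<one>}"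
    using least_pow_in_subgroup[OF fin _ x(1)] by blast
  have "m \<noteq> 1" using m(2) x by auto
  have "card {z::complex. z ^ m = 1} = m" using m(1) by (intro card_roots_unity_eq)
  then have "\<not> {z::complex. z ^ m = 1} \<subseteq> {1}"
    using card_mono[of "{1::complex}" "{z. z ^ m = 1}"] m(1) \<open>m \<noteq> 1\<close> by auto
  then obtain z :: complex where z: "z ^ m = 1" "z \<noteq> 1" by auto
  obtain K \<phi> where K: "partial_character K \<phi>" "x \<in> K" "\<phi> x = z"
    using extend_partial_character[OF fin triv x(1) m z(1)] by metis
  obtain \<psi> where \<psi>: "partial_character (carrier G) \<psi>" "\<psi> x = z"
    using partial_character_extends[OF fin K(1)] K(2,3) by metis
  have "cmod (\<psi> y) = 1" if y: "y \<in> carrier G" for y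
  proof -
    have "\<psi> y ^ order G = 1"
      using partial_character_pow(2)[OF \<psi>(1) y, of "order G"] \<psi>(1) y
      by (simp add: pow_order_eq_1 partial_character_def)
    then have "cmod (\<psi> y) ^ order G = 1" by (metis norm_one norm_power)
    then show ?thesis
      using fin order_gt_0_iff_finite power_eq_iff_eq_base[of "order G" "cmod (\<psi> y)" 1] by simp
  qed
  then have "restrict \<psi> (carrier G) \<in> dual_group G"
    using \<psi>(1) by (intro dual_groupI) (auto simp: partial_character_def)
  then show thesis using that \<psi>(2) z(2) x(1) by (metis restrict_apply')
qed

lemma finite_dual_group:
  assumes "finite (carrier G)"
  shows "finite (dual_group G)"
proof (rule finite_subset)
  have n: "0 < order G" using assms order_gt_0_iff_finite by blast
  show "dual_group G \<subseteq> carrier G \<rightarrow>\<^sub>E {z. z ^ order G = 1}"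
  proof
    fix \<chi> assume \<chi>: "\<chi> \<in> dual_group G"
    then have "partial_character (carrier G) \<chi>"
      by (simp add: partial_character_def dual_groupD subgroup_self)
    then have "\<chi> x ^ order G = 1" if "x \<in> carrier G" for x
      using partial_character_pow(2)[of "carrier G" \<chi> x "order G"] that
      by (simp add: pow_order_eq_1 dual_group_one[OF \<chi>])
    then show "\<chi> \<in> carrier G \<rightarrow>\<^sub>E {z. z ^ order G = 1}"
      using \<chi> by (auto simp: dual_group_def PiE_def)
  qed
  show "finite (carrier G \<rightarrow>\<^sub>E {z::complex. z ^ order G = 1})"
    using assms n by (intro finite_PiE finite_roots_unity) auto
qed

lemma bij_betw_translation:
  assumes "a \<in> carrier G"
  shows "bij_betw (\<lambda>x. a \<otimes> x) (carrier G) (carrier G)"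
  using assms by (intro bij_betwI[where g = "\<lambda>x. inv a \<otimes> x"]) (auto simp: m_assoc[symmetric])

lemma sum_character:
  assumes "\<chi> \<in> dual_group G" "a \<in> carrier G" "\<chi> a \<noteq> 1"
  shows "(\<Sum>x\<in>carrier G. \<chi> x) = 0"
proof -
  have "(\<Sum>x\<in>carrier G. \<chi> x) = (\<Sum>x\<in>carrier G. \<chi> (a \<otimes> x))"
    using sum.reindex_bij_betw[OF bij_betw_translation[OF assms(2)]] by metis
  also have "\<dots> = \<chi> a * (\<Sum>x\<in>carrier G. \<chi> x)"
    using assms by (simp add: sum_distrib_left dual_group_mult)
  finally show ?thesis using assms(3) by auto
qed

lemma sum_dual_group_nontrivial:
  assumes fin: "finite (carrier G)" and x: "x \<in> carrier G" "x \<noteq> \<one>"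
  shows "(\<Sum>\<chi>\<in>dual_group G. \<chi> x) = 0"
proof -
  obtain \<psi> where \<psi>: "\<psi> \<in> dual_group G" "\<psi> x \<noteq> 1"
    using dual_group_separates[OF assms] .
  define T where "T \<chi> = (\<lambda>g\<in>carrier G. \<psi> g * \<chi> g)" for \<chi>
  have T: "T ` dual_group G \<subseteq> dual_group G"
    unfolding T_def using \<psi>(1)
    by (auto intro!: dual_groupI simp: dual_group_mult dual_group_norm norm_mult)
  have inj: "inj_on T (dual_group G)"
  proof (intro inj_onI dual_group_eqI)
    fix \<chi> \<phi> g assume "T \<chi> = T \<phi>" and g: "g \<in> carrier G"
    then have "T \<chi> g = T \<phi> g" by simp
    then have "\<psi> g * \<chi> g = \<psi> g * \<phi> g" using g by (simp add: T_def)
    then show "\<chi> g = \<phi> g" using dual_group_norm[OF \<psi>(1) g] by auto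
  qed
  have "T ` dual_group G = dual_group G"
    using finite_dual_group[OF fin] T inj by (rule endo_inj_surj)
  then have "(\<Sum>\<chi>\<in>dual_group G. \<chi> x) = (\<Sum>\<chi>\<in>dual_group G. T \<chi> x)"
    using sum.reindex[OF inj, of "\<lambda>\<chi>. \<chi> x"] by simp
  also have "\<dots> = \<psi> x * (\<Sum>\<chi>\<in>dual_group G. \<chi> x)"
    using x by (simp add: T_def sum_distrib_left)
  finally show ?thesis using \<psi>(2) by auto
qed

(* Double counting: both sides are the sum of all entries of the character table. *)
lemma card_dual_group:
  assumes fin: "finite (carrier G)"
  shows "card (dual_group G) = order G"
proof -
  define \<epsilon> where "\<epsilon> = (\<lambda>x\<in>carrier G. 1 :: complex)"
  have \<epsilon>: "\<epsilon> \<in> dual_group G" unfolding \<epsilon>_def by (rule dual_groupI) auto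
  have row: "(\<Sum>x\<in>carrier G. \<chi> x) = (if \<chi> = \<epsilon> then of_nat (order G) else 0)"
    if \<chi>: "\<chi> \<in> dual_group G" for \<chi>
  proof (cases "\<chi> = \<epsilon>")
    case True
    then show ?thesis by (simp add: \<epsilon>_def order_def)
  next
    case False
    then obtain a where "a \<in> carrier G" "\<chi> a \<noteq> 1"
      using dual_group_eqI[OF \<chi> \<epsilon>] by (auto simp: \<epsilon>_def)
    then show ?thesis using False sum_character[OF \<chi>] by simp
  qed
  have "of_nat (card (dual_group G)) = (\<Sum>\<chi>\<in>dual_group G. \<chi> \<one>)"
    by (simp add: dual_group_one)
  also have "\<dots> = (\<Sum>x\<in>carrier G. if x = \<one> then \<Sum>\<chi>\<in>dual_group G. \<chi> \<one> else 0)"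
    using fin by (simp add: sum.delta)
  also have "\<dots> = (\<Sum>x\<in>carrier G. \<Sum>\<chi>\<in>dual_group G. \<chi> x)"
    by (intro sum.cong) (auto simp: sum_dual_group_nontrivial[OF fin])
  also have "\<dots> = (\<Sum>\<chi>\<in>dual_group G. if \<chi> = \<epsilon> then of_nat (order G) else 0)"
    by (subst sum.swap) (simp add: row)
  also have "\<dots> = of_nat (order G)"
    using finite_dual_group[OF fin] \<epsilon> by (simp add: sum.delta)
  finally show ?thesis using of_nat_eq_iff by blast
qed

lemma dual_group_orthogonality:
  assumes fin: "finite (carrier G)" and xy: "x \<in> carrier G" "y \<in> carrier G"
  shows "(\<Sum>\<chi>\<in>dual_group G. cnj (\<chi> y) * \<chi> x) = (if y = x then of_nat (order G) else 0)"
proof -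
  have "(\<Sum>\<chi>\<in>dual_group G. cnj (\<chi> y) * \<chi> x) = (\<Sum>\<chi>\<in>dual_group G. \<chi> (inv y \<otimes> x))"
    using xy by (intro sum.cong) (auto simp: dual_group_mult dual_group_inv)
  moreover have "inv y \<otimes> x = \<one> \<longleftrightarrow> y = x"
    using xy by (metis inv_equality inv_inv l_inv inv_closed)
  ultimately show ?thesis
    using sum_dual_group_nontrivial[OF fin, of "inv y \<otimes> x"] card_dual_group[OF fin] xy
    by (simp add: dual_group_one)
qed

lemma fourier_inversion:
  assumes fin: "finite (carrier G)" and x: "x \<in> carrier G"
  shows "1 / of_nat (order G) *
    (\<Sum>\<chi>\<in>dual_group G. \<Sum>y\<in>carrier G. f y * cnj (\<chi> y) * \<chi> x) = f x"
proof -
  have "(\<Sum>\<chi>\<in>dual_group G. \<Sum>y\<in>carrier G. f y * cnj (\<chi> y) * \<chi> x) =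
      (\<Sum>y\<in>carrier G. f y * (\<Sum>\<chi>\<in>dual_group G. cnj (\<chi> y) * \<chi> x))"
    by (subst sum.swap) (simp add: sum_distrib_left mult.assoc)
  also have "\<dots> = (\<Sum>y\<in>carrier G. if y = x then f y * of_nat (order G) else 0)"
    by (intro sum.cong) (auto simp: dual_group_orthogonality[OF fin x])
  also have "\<dots> = f x * of_nat (order G)" using fin x by (simp add: sum.delta)
  finally show ?thesis using fin order_gt_0_iff_finite by simp
qed

lemma diffusion_operator_apply:
  assumes fin: "finite (carrier G)" and S: "S \<subseteq> carrier G" and x: "x \<in> carrier G"
  shows "diffusion_operator G S \<alpha> f x =
    (of_nat (card S) + of_real \<alpha>) * f x - (\<Sum>s\<in>S. f (inv s \<otimes> x))"
proof -
  have "(\<Sum>y\<in>carrier G. char_fun G S y * f (inv y \<otimes> x)) = (\<Sum>s\<in>S. f (inv s \<otimes> x))"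
    using assms by (intro sum.mono_neutral_cong_right) (auto simp: char_fun_def)
  then show ?thesis
    using x by (simp add: diffusion_operator_def laplacian_def convolution_def algebra_simps)
qed

lemma fourier_diffusion_operator:
  assumes fin: "finite (carrier G)" and S: "S \<subseteq> carrier G" and \<chi>: "\<chi> \<in> dual_group G"
  shows "(\<Sum>y\<in>carrier G. diffusion_operator G S \<alpha> f y * cnj (\<chi> y)) =
    (cayley_eigenvalue S \<chi> + of_real \<alpha>) * (\<Sum>y\<in>carrier G. f y * cnj (\<chi> y))"
proof -
  let ?F = "\<Sum>y\<in>carrier G. f y * cnj (\<chi> y)"
  have shift: "(\<Sum>y\<in>carrier G. f (inv s \<otimes> y) * cnj (\<chi> y)) = cnj (\<chi> s) * ?F" if "s \<in> S" for s
  proof -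
    have s: "s \<in> carrier G" using that S by auto
    have "(\<Sum>y\<in>carrier G. f (inv s \<otimes> y) * cnj (\<chi> y)) =
        (\<Sum>y\<in>carrier G. f (inv s \<otimes> (s \<otimes> y)) * cnj (\<chi> (s \<otimes> y)))"
      using sum.reindex_bij_betw[OF bij_betw_translation[OF s],
          of "\<lambda>y. f (inv s \<otimes> y) * cnj (\<chi> y)"] by simp
    also have "\<dots> = cnj (\<chi> s) * ?F"
      using s \<chi> by (simp add: m_assoc[symmetric] dual_group_mult sum_distrib_left mult_ac)
    finally show ?thesis .
  qed
  have "(\<Sum>y\<in>carrier G. diffusion_operator G S \<alpha> f y * cnj (\<chi> y)) =
      (of_nat (card S) + of_real \<alpha>) * ?F - (\<Sum>y\<in>carrier G. \<Sum>s\<in>S. f (inv s \<otimes> y) * cnj (\<chi> y))"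
    by (simp add: diffusion_operator_apply[OF fin S] left_diff_distrib sum_subtractf
        sum_distrib_left sum_distrib_right mult.assoc)
  also have "(\<Sum>y\<in>carrier G. \<Sum>s\<in>S. f (inv s \<otimes> y) * cnj (\<chi> y)) = (\<Sum>s\<in>S. cnj (\<chi> s)) * ?F"
    by (subst sum.swap) (simp add: shift sum_distrib_right)
  finally show ?thesis by (simp add: cayley_eigenvalue_def algebra_simps)
qed

lemma diffusion_operator_character:
  assumes fin: "finite (carrier G)" and S: "S \<subseteq> carrier G" and \<chi>: "\<chi> \<in> dual_group G"
    and x: "x \<in> carrier G"
  shows "diffusion_operator G S \<alpha> \<chi> x = (cayley_eigenvalue S \<chi> + of_real \<alpha>) * \<chi> x"
proof -
  have "(\<Sum>s\<in>S. \<chi> (inv s \<otimes> x)) = (\<Sum>s\<in>S. cnj (\<chi> s)) * \<chi> x"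
    unfolding sum_distrib_right using S x
    by (intro sum.cong) (auto simp: dual_group_mult[OF \<chi>] dual_group_inv[OF \<chi>])
  then show ?thesis
    by (simp add: diffusion_operator_apply[OF fin S x] cayley_eigenvalue_def algebra_simps)
qed

lemma diffusion_operator_sum:
  assumes fin: "finite (carrier G)" and S: "S \<subseteq> carrier G" and x: "x \<in> carrier G"
  shows "diffusion_operator G S \<alpha> (\<lambda>g\<in>carrier G. \<Sum>i\<in>I. c i * u i g) x =
    (\<Sum>i\<in>I. c i * diffusion_operator G S \<alpha> (u i) x)"
proof -
  have "(\<Sum>s\<in>S. (\<lambda>g\<in>carrier G. \<Sum>i\<in>I. c i * u i g) (inv s \<otimes> x)) =
      (\<Sum>s\<in>S. \<Sum>i\<in>I. c i * u i (inv s \<otimes> x))"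
    using S x by (intro sum.cong) auto
  also have "\<dots> = (\<Sum>i\<in>I. c i * (\<Sum>s\<in>S. u i (inv s \<otimes> x)))"
    by (subst sum.swap) (simp add: sum_distrib_left)
  finally show ?thesis
    using x by (simp add: diffusion_operator_apply[OF fin S x] right_diff_distrib sum_subtractf
        sum_distrib_left mult_ac)
qed

lemma cayley_eigenvalue_plus_nonzero:
  assumes S: "S \<subseteq> carrier G" and \<chi>: "\<chi> \<in> dual_group G" and \<alpha>: "0 < \<alpha>"
  shows "cayley_eigenvalue S \<chi> + of_real \<alpha> \<noteq> 0"
proof -
  have "Re (cnj (\<chi> s)) \<le> 1" if "s \<in> S" for s
    using complex_Re_le_cmod[of "\<chi> s"] dual_group_norm[OF \<chi>, of s] S that by auto
  then have "(\<Sum>s\<in>S. Re (cnj (\<chi> s))) \<le> (\<Sum>s\<in>S. 1)" by (intro sum_mono)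
  then have "0 < Re (cayley_eigenvalue S \<chi> + of_real \<alpha>)"
    using \<alpha> by (simp add: cayley_eigenvalue_def)
  then show ?thesis by (metis less_irrefl zero_complex.sel(1))
qed

end

theorem corollary7:
  fixes G :: "('a, 'b) monoid_scheme" and S :: "'a set" and \<alpha>\<^sub>0 :: real
  assumes "comm_group G" and "finite (carrier G)"
    and "symmetric_subset G S"
    and "\<alpha>\<^sub>0 > 0"
  shows "bij_betw (diffusion_operator G S \<alpha>\<^sub>0) (ell2 G) (ell2 G) \<and>
    (\<forall>f\<in>ell2 G. \<forall>x\<in>carrier G.
      greens_function G S \<alpha>\<^sub>0 f x =
        1 / of_nat (order G) *
        (\<Sum>\<chi>\<in>dual_group G. \<Sum>y\<in>carrier G.
          1 / (cayley_eigenvalue S \<chi> + of_real \<alpha>\<^sub>0) * f y * cnj (\<chi> y) * \<chi> x))"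
proof -
  interpret comm_group G by fact
  note fin = assms(2)
  have S: "S \<subseteq> carrier G" using assms(3) by (simp add: symmetric_subset_def)
  let ?H = "diffusion_operator G S \<alpha>\<^sub>0"
  define \<mu> where "\<mu> \<chi> = cayley_eigenvalue S \<chi> + of_real \<alpha>\<^sub>0" for \<chi>
  have \<mu>: "\<mu> \<chi> \<noteq> 0" if "\<chi> \<in> dual_group G" for \<chi>
    unfolding \<mu>_def using cayley_eigenvalue_plus_nonzero[OF S that assms(4)] .
  define c where "c f \<chi> = 1 / of_nat (order G) * (1 / \<mu> \<chi> * (\<Sum>y\<in>carrier G. f y * cnj (\<chi> y)))"
    for f \<chi>
  define T where "T f = (\<lambda>x\<in>carrier G. \<Sum>\<chi>\<in>dual_group G. c f \<chi> * \<chi> x)" for f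
  have T_eq: "T f x = 1 / of_nat (order G) *
      (\<Sum>\<chi>\<in>dual_group G. \<Sum>y\<in>carrier G. 1 / \<mu> \<chi> * f y * cnj (\<chi> y) * \<chi> x)"
    if "x \<in> carrier G" for f x
    using that by (simp add: T_def c_def sum_distrib_left sum_distrib_right mult_ac)
  have HT: "?H (T f) x = f x" if x: "x \<in> carrier G" for f x
  proof -
    have "?H (T f) x = (\<Sum>\<chi>\<in>dual_group G. c f \<chi> * ?H \<chi> x)"
      unfolding T_def by (rule diffusion_operator_sum[OF fin S x])
    also have "\<dots> = (\<Sum>\<chi>\<in>dual_group G. c f \<chi> * (\<mu> \<chi> * \<chi> x))"
      using x by (simp add: diffusion_operator_character[OF fin S] \<mu>_def)
    also have "\<dots> = (\<Sum>\<chi>\<in>dual_group G. 1 / of_nat (order G) * (\<Sum>y\<in>carrier G. f y * cnj (\<chi> y) * \<chi> x))"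
      using \<mu> by (intro sum.cong) (simp_all add: c_def sum_distrib_right[symmetric])
    also have "\<dots> = f x"
      using fourier_inversion[OF fin x, of f] by (simp add: sum_distrib_left)
    finally show ?thesis .
  qed
  have TH: "T (?H f) x = f x" if x: "x \<in> carrier G" for f x
  proof -
    have "c (?H f) \<chi> = 1 / of_nat (order G) * (\<Sum>y\<in>carrier G. f y * cnj (\<chi> y))"
      if "\<chi> \<in> dual_group G" for \<chi>
      using \<mu>[OF that] fourier_diffusion_operator[OF fin S that, of \<alpha>\<^sub>0 f] by (simp add: c_def \<mu>_def)
    then have "T (?H f) x =
        (\<Sum>\<chi>\<in>dual_group G. 1 / of_nat (order G) * (\<Sum>y\<in>carrier G. f y * cnj (\<chi> y) * \<chi> x))"
      using x by (simp add: T_def sum_distrib_right)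
    also have "\<dots> = f x"
      using fourier_inversion[OF fin x, of f] by (simp add: sum_distrib_left)
    finally show ?thesis .
  qed
  have H_ell2: "?H f \<in> ell2 G" and T_ell2: "T f \<in> ell2 G" for f
    by (auto simp: ell2_def diffusion_operator_def T_def)
  have ext: "f = g" if "f \<in> ell2 G" "g \<in> ell2 G" "\<And>x. x \<in> carrier G \<Longrightarrow> f x = g x" for f g
    using that unfolding ell2_def by (rule PiE_ext)
  have bij: "bij_betw ?H (ell2 G) (ell2 G)"
    using H_ell2 T_ell2 HT TH ext by (intro bij_betwI[where g = T]) auto
  moreover have "greens_function G S \<alpha>\<^sub>0 f x = T f x" if f: "f \<in> ell2 G" for f x
  proof -
    have "?H (T f) = f" using ext[OF H_ell2 f HT] .
    then show ?thesis
      unfolding greens_function_def using inv_into_f_eq[OF bij_betw_imp_inj_on[OF bij] T_ell2] by metis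
  qed
  ultimately show ?thesis using T_eq by (simp add: \<mu>_def)
qed

end
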